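(* Let $T\in\mathcal T^m$ be a simplex of maximal dimension. The action $\mathcal S'_T$ is invariant under discrete gauge transformations. That is, for every family $(G_i)_{i\in\mathcal T^0}$ of elements of $\mathbb G$, and for all $A,A'\in W^1(\mathcal T)\otimes\mathfrak g$ whose parallel transports $U_{ji}=\exp(-A_{ji})$ and $U'_{ji}=\exp(-A'_{ji})$ are related by $$U'_{ji}=G_j\,U_{ji}\,G_i^{-1}\quad\text{for all edges } ji,$$ one has $$\mathcal S'_T(A')=\mathcal S'_T(A).$$
   Context: $\mathbb G$ is a compact Lie group, realised as a subgroup of the unitary group of complex $N\times N$ matrices, with Lie algebra $\mathfrak g$. $g^{\mathsf H}$ denotes the Hermitian conjugate of a matrix, $\mathbf 1$ the unit matrix, and $\mathrm{Re}\,\mathrm{tr}$ the real part of the trace. $\mathcal T$ is a simplicial complex spanning a bounded domain of $m$-dimensional Euclidean space, $\mathcal T^k$ its set of $k$-dimensional simplexes, each with a chosen orientation. $\lambda_i$ is the barycentric coordinate map (continuous, piecewise affine, $1$ at vertex $i$ and $0$ at other vertexes). For an edge oriented from $i$ to $j$, $\lambda_{ji}=\lambda_i\,d\lambda_j-\lambda_j\,d\lambda_i$. For a face with vertexes ordered $i\to j\to k$ according to its orientation, $\lambda_{kji}=2(\lambda_i\,d\lambda_j\wedge d\lambda_k-\lambda_j\,d\lambda_i\wedge d\lambda_k+\lambda_k\,d\lambda_i\wedge d\lambda_j)$. $W^1(\mathcal T)$ is the span of the $\lambda_e$, $e\in\mathcal T^1$ (Whitney $1$-forms). Each $A\in W^1(\mathcal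 T)\otimes\mathfrak g$ is written $A=\sum_{ji\in\mathcal T^1}A_{ji}\lambda_{ji}$ with $A_{ji}=\int_{ji}A\in\mathfrak g$, with conventions $A_{ij}=-A_{ji}$ and $A_{ii}=0$. The parallel transports of $A$ are $U_{ji}=\exp(-A_{ji})\in\mathbb G$, so $U_{ij}=U_{ji}^{-1}$ and $U_{ii}=\mathbf 1$. For each two-dimensional face $f$ an orientation and a distinguished vertex $\dot f$ (its origin) are chosen. If $f$ has vertexes ordered $i\to j\to k$ with $\dot f=i$, set $F_f=F_{kji}=U_{ik}U_{kj}U_{ji}$. The mass matrix is $M_{f_0f_1}(T)=\int_T\lambda_{f_0}\cdot\lambda_{f_1}$, where $\cdot$ is the Euclidean scalar product of alternating $2$-forms. The discrete action is $$\mathcal S'_T(A)=\sum_{f_0,f_1}M_{f_0f_1}(T)\,\mathrm{Re}\,\mathrm{tr}\big(U_{\dot f_1\dot f_0}(\mathbf 1-F_{f_0}^{\mathsf H})U_{\dot f_0\dot f_1}(\mathbf 1-F_{f_1})\big),$$ the sum being over pairs of two-dimensional faces $f_0,f_1$ of $T$. *)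

theory Defs
  imports "HOL-Analysis.Analysis"
begin

section \<open>Matrix groups\<close>

text \<open>The library has no exponential of matrices: its ring multiplication of vectors, and hence
  its power, is componentwise, and \<^const>\<open>exp\<close> needs a normed algebra.\<close>

definition hermitian_conj :: "complex^'n^'m \<Rightarrow> complex^'m^'n" where
  "hermitian_conj A = (\<chi> i j. cnj (A $ j $ i))"

definition unitary_mat :: "complex^'n^'n \<Rightarrow> bool" where
  "unitary_mat A \<longleftrightarrow> hermitian_conj A ** A = mat 1 \<and> A ** hermitian_conj A = mat 1"

definition mexp :: "complex^'n^'n \<Rightarrow> complex^'n^'n" where
  "mexp A = (\<Sum>k. (1 / fact k) *\<^sub>R (((**) A ^^ k) (mat 1)))"

text \<open>By Cartan's closed subgroup theorem the compact subgroups of the unitary group are exactly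
  the compact Lie groups realised as subgroups of it.\<close>

definition compact_unitary_group :: "(complex^'n^'n) set \<Rightarrow> bool" where
  "compact_unitary_group \<G> \<longleftrightarrow>
     compact \<G> \<and> (\<forall>A\<in>\<G>. unitary_mat A) \<and> mat 1 \<in> \<G> \<and>
     (\<forall>A\<in>\<G>. \<forall>B\<in>\<G>. A ** B \<in> \<G>) \<and> (\<forall>A\<in>\<G>. matrix_inv A \<in> \<G>)"

definition lie_algebra :: "(complex^'n^'n) set \<Rightarrow> (complex^'n^'n) set" where
  "lie_algebra \<G> = {X. \<forall>t::real. mexp (t *\<^sub>R X) \<in> \<G>}"


section \<open>Oriented simplicial complexes\<close>

definition vertexes :: "'a::euclidean_space set \<Rightarrow> 'a set" where
  "vertexes S = {v. v extreme_point_of S}"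

definition simplexes :: "'a::euclidean_space set set \<Rightarrow> nat \<Rightarrow> 'a set set" where
  "simplexes \<T> k = {S \<in> \<T>. int k simplex S}"

definition spans_bounded_domain :: "'a::euclidean_space set set \<Rightarrow> bool" where
  "spans_bounded_domain \<T> \<longleftrightarrow>
     (\<exists>\<Omega>. open \<Omega> \<and> connected \<Omega> \<and> \<Omega> \<noteq> {} \<and> bounded \<Omega> \<and> \<Union>\<T> = closure \<Omega>)"

text \<open>The orientation of a simplex is given by an enumeration of its vertexes: for an edge,
  \<open>[i, j]\<close> means from \<open>i\<close> to \<open>j\<close>; for a face, \<open>[i, j, k]\<close> means \<open>i \<rightarrow> j \<rightarrow> k\<close>, and the rotations of
  this list give the same orientation.\<close>

definition orientation :: "'a::euclidean_space set set \<Rightarrow> ('a set \<Rightarrow> 'a list) \<Rightarrow> bool" where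
  "orientation \<T> ori \<longleftrightarrow> (\<forall>S\<in>\<T>. distinct (ori S) \<and> set (ori S) = vertexes S)"

definition origins :: "'a::euclidean_space set set \<Rightarrow> ('a set \<Rightarrow> 'a) \<Rightarrow> bool" where
  "origins \<T> org \<longleftrightarrow> (\<forall>f \<in> simplexes \<T> 2. org f \<in> vertexes f)"

text \<open>The rotation of \<open>xs\<close> that starts with \<open>v\<close>, for \<open>v \<in> set xs\<close>.\<close>

definition starting_at :: "'a \<Rightarrow> 'a list \<Rightarrow> 'a list" where
  "starting_at v xs = dropWhile (\<lambda>u. u \<noteq> v) xs @ takeWhile (\<lambda>u. u \<noteq> v) xs"


section \<open>Whitney forms\<close>

text \<open>The value \<open>0\<close> outside of the complex only serves to make the map unique.\<close>

definition bary :: "'a::euclidean_space set set \<Rightarrow> 'a \<Rightarrow> 'a \<Rightarrow> real" where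
  "bary \<T> i = (THE l.
     continuous_on (\<Union>\<T>) l \<and>
     (\<forall>S\<in>\<T>. \<exists>L c. linear L \<and> (\<forall>x\<in>S. l x = L x + c)) \<and>
     (\<forall>j. {j} \<in> \<T> \<longrightarrow> l j = (if j = i then 1 else 0)) \<and>
     (\<forall>x. x \<notin> \<Union>\<T> \<longrightarrow> l x = 0))"

text \<open>The differential of a piecewise affine map jumps across the simplexes of maximal dimension,
  but it has a well-defined restriction to the directions tangent to each simplex. Forms are
  therefore given simplex by simplex: the arguments of a form are a simplex \<open>S\<close>, a point of \<open>S\<close> and
  vectors tangent to \<open>S\<close>. The differential on \<open>S\<close> is extended by \<open>0\<close> to the directions orthogonal
  to \<open>S\<close>, of which there are none if \<open>S\<close> has maximal dimension.\<close>

definition differential :: "('a::euclidean_space \<Rightarrow> real) \<Rightarrow> 'a set \<Rightarrow> 'a \<Rightarrow> real" where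
  "differential l S = (THE L.
     linear L \<and> (\<forall>x\<in>S. \<forall>y\<in>S. l y - l x = L (y - x)) \<and>
     (\<forall>v. (\<forall>x\<in>S. \<forall>y\<in>S. v \<bullet> (y - x) = 0) \<longrightarrow> L v = 0))"

definition wedge :: "('a \<Rightarrow> real) \<Rightarrow> ('a \<Rightarrow> real) \<Rightarrow> 'a \<Rightarrow> 'a \<Rightarrow> real" where
  "wedge \<alpha> \<beta> v w = \<alpha> v * \<beta> w - \<alpha> w * \<beta> v"

definition whitney1 ::
  "'a::euclidean_space set set \<Rightarrow> ('a set \<Rightarrow> 'a list) \<Rightarrow> 'a set \<Rightarrow> 'a set \<Rightarrow> 'a \<Rightarrow> 'a \<Rightarrow> real" where
  "whitney1 \<T> ori e S x v =
     (let i = ori e ! 0; j = ori e ! 1; d = (\<lambda>p. differential (bary \<T> p) S)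
      in bary \<T> i x * d j v - bary \<T> j x * d i v)"

definition whitney2 ::
  "'a::euclidean_space set set \<Rightarrow> ('a set \<Rightarrow> 'a list) \<Rightarrow> 'a set \<Rightarrow> 'a set \<Rightarrow> 'a \<Rightarrow> 'a \<Rightarrow> 'a \<Rightarrow> real" where
  "whitney2 \<T> ori f S x v w =
     (let i = ori f ! 0; j = ori f ! 1; k = ori f ! 2; d = (\<lambda>p. differential (bary \<T> p) S)
      in 2 * (bary \<T> i x * wedge (d j) (d k) v w
            - bary \<T> j x * wedge (d i) (d k) v w
            + bary \<T> k x * wedge (d i) (d j) v w))"

text \<open>\<open>W\<^sup>1(\<T>) \<otimes> \<gg>\<close>, as matrix valued forms.\<close>

definition whitney1_forms ::
  "'a::euclidean_space set set \<Rightarrow> ('a set \<Rightarrow> 'a list) \<Rightarrow> (complex^'n^'n) set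
     \<Rightarrow> ('a set \<Rightarrow> 'a \<Rightarrow> 'a \<Rightarrow> complex^'n^'n) set" where
  "whitney1_forms \<T> ori \<gg> =
     {A. \<exists>a. (\<forall>e \<in> simplexes \<T> 1. a e \<in> \<gg>) \<and>
             A = (\<lambda>S x v. \<Sum>e \<in> simplexes \<T> 1. whitney1 \<T> ori e S x v *\<^sub>R a e)}"

text \<open>The integral along the edge with end points \<open>i\<close> and \<open>j\<close>, from \<open>i\<close> to \<open>j\<close>.\<close>

definition edge_integral ::
  "('a::euclidean_space set \<Rightarrow> 'a \<Rightarrow> 'a \<Rightarrow> complex^'n^'n) \<Rightarrow> 'a \<Rightarrow> 'a \<Rightarrow> complex^'n^'n" where
  "edge_integral A j i =
     integral {0..1} (\<lambda>t. A (closed_segment i j) (i + t *\<^sub>R (j - i)) (j - i))"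

text \<open>\<open>A\<^sub>j\<^sub>i\<close>, with \<open>A\<^sub>i\<^sub>j = - A\<^sub>j\<^sub>i\<close> and \<open>A\<^sub>i\<^sub>i = 0\<close>; it is also set to \<open>0\<close> if \<open>i\<close> and \<open>j\<close> are not
  joined by an edge.\<close>

definition coefficient ::
  "'a::euclidean_space set set \<Rightarrow> ('a set \<Rightarrow> 'a list) \<Rightarrow> ('a set \<Rightarrow> 'a \<Rightarrow> 'a \<Rightarrow> complex^'n^'n)
     \<Rightarrow> 'a \<Rightarrow> 'a \<Rightarrow> complex^'n^'n" where
  "coefficient \<T> ori A j i =
     (if closed_segment i j \<in> simplexes \<T> 1
      then if ori (closed_segment i j) = [i, j] then edge_integral A j i else - edge_integral A i j
      else 0)"

definition transport ::
  "'a::euclidean_space set set \<Rightarrow> ('a set \<Rightarrow> 'a list) \<Rightarrow> ('a set \<Rightarrow> 'a \<Rightarrow> 'a \<Rightarrow> complex^'n^'n)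
     \<Rightarrow> 'a \<Rightarrow> 'a \<Rightarrow> complex^'n^'n" where
  "transport \<T> ori A j i = mexp (- coefficient \<T> ori A j i)"


section \<open>The discrete action\<close>

definition face_holonomy ::
  "'a::euclidean_space set set \<Rightarrow> ('a set \<Rightarrow> 'a list) \<Rightarrow> ('a set \<Rightarrow> 'a)
     \<Rightarrow> ('a set \<Rightarrow> 'a \<Rightarrow> 'a \<Rightarrow> complex^'n^'n) \<Rightarrow> 'a set \<Rightarrow> complex^'n^'n" where
  "face_holonomy \<T> ori org A f =
     (let l = starting_at (org f) (ori f); i = l ! 0; j = l ! 1; k = l ! 2; U = transport \<T> ori A
      in U i k ** U k j ** U j i)"

text \<open>The scalar product for which the \<open>dx\<^sub>a \<and> dx\<^sub>b\<close> with \<open>a < b\<close> are orthonormal. The factor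
  \<open>1 / 2\<close> is there because the sum is over all ordered pairs of basis vectors.\<close>

definition inner_2forms ::
  "('a::euclidean_space \<Rightarrow> 'a \<Rightarrow> real) \<Rightarrow> ('a \<Rightarrow> 'a \<Rightarrow> real) \<Rightarrow> real" where
  "inner_2forms \<omega> \<eta> = (\<Sum>a\<in>Basis. \<Sum>b\<in>Basis. \<omega> a b * \<eta> a b) / 2"

definition mass_matrix ::
  "'a::euclidean_space set set \<Rightarrow> ('a set \<Rightarrow> 'a list) \<Rightarrow> 'a set \<Rightarrow> 'a set \<Rightarrow> 'a set \<Rightarrow> real" where
  "mass_matrix \<T> ori T f\<^sub>0 f\<^sub>1 =
     integral T (\<lambda>x. inner_2forms (whitney2 \<T> ori f\<^sub>0 T x) (whitney2 \<T> ori f\<^sub>1 T x))"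

definition discrete_action ::
  "'a::euclidean_space set set \<Rightarrow> ('a set \<Rightarrow> 'a list) \<Rightarrow> ('a set \<Rightarrow> 'a) \<Rightarrow> 'a set
     \<Rightarrow> ('a set \<Rightarrow> 'a \<Rightarrow> 'a \<Rightarrow> complex^'n^'n) \<Rightarrow> real" where
  "discrete_action \<T> ori org T A =
     (let faces = {f \<in> simplexes \<T> 2. f face_of T};
          U = transport \<T> ori A;
          F = face_holonomy \<T> ori org A
      in \<Sum>f\<^sub>0\<in>faces. \<Sum>f\<^sub>1\<in>faces. mass_matrix \<T> ori T f\<^sub>0 f\<^sub>1 *
           Re (trace (U (org f\<^sub>1) (org f\<^sub>0) ** (mat 1 - hermitian_conj (F f\<^sub>0)) **
                      U (org f\<^sub>0) (org f\<^sub>1) ** (mat 1 - F f\<^sub>1))))"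

end

theory Submission
  imports Defs
begin

text \<open>Under a gauge transformation, the holonomy of a face and each transport between origins
  are conjugated by the values of \<open>G\<close> at the origins, and the factors \<open>G\<^sub>i\<close> of neighbouring
  matrices cancel in the trace; unitarity is what lets the Hermitian conjugate of a holonomy
  transform in the same way. The hypothesis relates the transports along oriented edges only;
  for the reverse direction one needs \<open>exp (- X) exp X = 1\<close> for matrices.\<close>

section \<open>Matrices\<close>

text \<open>The sum of the moduli of all entries of \<open>A\<close> plays the part of a
  submultiplicative norm: each multiplication by \<open>A\<close> costs this one factor in a bound
  uniform over the entries, so that an induction controls all powers of \<open>A\<close>.\<close>

lemma norm_matrix_mul_component_le:
  fixes A B :: "complex^'n^'n"
  assumes "\<And>i j. norm (B $ i $ j) \<le> b"
  shows "norm ((A ** B) $ i $ j) \<le> (\<Sum>r\<in>UNIV. \<Sum>s\<in>UNIV. norm (A $ r $ s)) * b"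
proof -
  have b: "0 \<le> b"
    using assms norm_ge_zero order_trans by blast
  have "norm ((A ** B) $ i $ j) \<le> (\<Sum>s\<in>UNIV. norm (A $ i $ s) * norm (B $ s $ j))"
    by (simp add: matrix_matrix_mult_def norm_mult sum_norm_le)
  also have "\<dots> \<le> (\<Sum>s\<in>UNIV. norm (A $ i $ s) * b)"
    by (intro sum_mono mult_left_mono assms) auto
  also have "\<dots> = (\<Sum>s\<in>UNIV. norm (A $ i $ s)) * b"
    by (simp add: sum_distrib_right)
  also have "\<dots> \<le> (\<Sum>r\<in>UNIV. \<Sum>s\<in>UNIV. norm (A $ r $ s)) * b"
    by (intro mult_right_mono member_le_sum b) (auto intro: sum_nonneg)
  finally show ?thesis .
qed

section \<open>Powers and the exponential series\<close>

abbreviation mpow :: "complex^'n^'n \<Rightarrow> nat \<Rightarrow> complex^'n^'n" where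
  "mpow A k \<equiv> ((**) A ^^ k) (mat 1)"

lemma mpow_add: "mpow A k ** mpow A l = mpow A (k + l)"
  by (induction k) (simp_all add: matrix_mul_assoc[symmetric])

lemma mpow_uminus:
  fixes A :: "complex^'n^'n"
  shows "mpow (- A) k = (- 1 :: real) ^ k *\<^sub>R mpow A k"
proof (induction k)
  case (Suc k)
  have "(- B) ** C = - (B ** C)" for B C :: "complex^'n^'n"
    by (simp add: vec_eq_iff matrix_matrix_mult_def sum_negf)
  then show ?case
    using Suc by (simp add: matrix_scalar_ac scalar_matrix_assoc[symmetric])
qed simp

lemma norm_mpow_component_le:
  "norm (mpow A k $ i $ j) \<le> (\<Sum>r\<in>UNIV. \<Sum>s\<in>UNIV. norm (A $ r $ s)) ^ k"
proof (induction k arbitrary: i j)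
  case 0
  then show ?case by (simp add: mat_def)
next
  case (Suc k)
  then show ?case
    using norm_matrix_mul_component_le[where B = "mpow A k" and A = A] by simp
qed

text \<open>Comparison with the real exponential series at the entry sum of \<open>A\<close>.
  Absolute convergence is what the Cauchy product of two such series requires.\<close>

lemma summable_norm_mexp_component:
  "summable (\<lambda>k. norm (((1 / fact k) *\<^sub>R mpow A k) $ i $ j))"
proof (rule summable_comparison_test[OF _ summable_exp])
  show "\<exists>N. \<forall>k\<ge>N. norm (norm (((1 / fact k) *\<^sub>R mpow A k) $ i $ j))
      \<le> inverse (fact k) * (\<Sum>r\<in>UNIV. \<Sum>s\<in>UNIV. norm (A $ r $ s)) ^ k"
    using norm_mpow_component_le[of _ A i j] by (simp add: divide_simps)
qed

text \<open>Convergence of matrices is entrywise, so the absolutely convergent entry series show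
  that the series in \<open>mexp\<close> truly converges and its sum is not an unspecified
  value.\<close>

lemma mexp_component: "mexp A $ i $ j = (\<Sum>k. ((1 / fact k) *\<^sub>R mpow A k) $ i $ j)"
proof -
  have "(\<lambda>k. ((1 / fact k) *\<^sub>R mpow A k)) sums
      (\<chi> i j. \<Sum>k. ((1 / fact k) *\<^sub>R mpow A k) $ i $ j)"
    unfolding sums_def
  proof (intro vec_tendstoI)
    fix i j
    show "(\<lambda>n. (\<Sum>k<n. (1 / fact k) *\<^sub>R mpow A k) $ i $ j) \<longlonglongrightarrow>
        (\<chi> i j. \<Sum>k. ((1 / fact k) *\<^sub>R mpow A k) $ i $ j) $ i $ j"
      using summable_LIMSEQ[OF summable_norm_cancel[OF summable_norm_mexp_component[of A i j]]]
      by simp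
  qed
  then show ?thesis
    unfolding mexp_def by (simp add: sums_iff)
qed

lemma mexp_0: "mexp (0 :: complex^'n^'n) = mat 1"
proof -
  have *: "mpow (0 :: complex^'n^'n) k = (if k = 0 then mat 1 else 0)" for k
    by (cases k) auto
  have "mexp (0 :: complex^'n^'n) $ i $ j = mat 1 $ i $ j" for i j
    unfolding mexp_component * by (subst suminf_finite[of "{0}"]) auto
  then show ?thesis by (simp add: vec_eq_iff)
qed

text \<open>In the Cauchy product of the two series, the binomial formula turns the terms of total
  degree \<open>k\<close> into a multiple of (1 - 1)^k, which vanishes unless \<open>k\<close> is
  0.\<close>

lemma mexp_mul_mexp_uminus: "mexp A ** mexp (- A) = mat 1"
proof -
  define a where "a k = (1 / fact k) *\<^sub>R mpow A k" for k
  define b where "b k = (1 / fact k) *\<^sub>R mpow (- A) k" for k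
  have prod: "(\<Sum>l\<le>k. a l ** b (k - l)) = (if k = 0 then mat 1 else 0)" for k
  proof -
    have "a l ** b (k - l) = ((- 1) ^ k / fact k * ((- 1) ^ l * (k choose l))) *\<^sub>R mpow A k"
      if "l \<le> k" for l
    proof -
      have "a l ** b (k - l) =
          (1 / (fact l * fact (k - l)) * (- 1) ^ (k - l)) *\<^sub>R mpow A k"
        using that unfolding a_def b_def mpow_uminus
        by (simp add: scalar_matrix_assoc[symmetric] matrix_scalar_ac mpow_add)
      also have "(- 1) ^ (k - l) = (- 1) ^ k * (- 1 :: real) ^ l"
        using that by (simp add: power_diff_conv_inverse flip: power_inverse)
      also have "1 / (fact l * fact (k - l)) = real (k choose l) / fact k"
        using that by (simp add: binomial_fact)
      finally show ?thesis by (simp add: mult_ac)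
    qed
    then have "(\<Sum>l\<le>k. a l ** b (k - l)) =
        ((- 1) ^ k / fact k * (\<Sum>l\<le>k. (- 1) ^ l * (k choose l))) *\<^sub>R mpow A k"
      by (simp add: sum_distrib_left scaleR_sum_left)
    then show ?thesis
      using choose_alternating_sum[of k, where 'a = real] by auto
  qed
  have "(mexp A ** mexp (- A)) $ i $ j = mat 1 $ i $ j" for i j
  proof -
    \<comment> \<open>The Cauchy product is taken for complex series, once for each intermediate
      index \<open>m\<close>; the finite sum over \<open>m\<close> then rebuilds the matrix
      product.\<close>
    have "(\<lambda>k. \<Sum>l\<le>k. a l $ i $ m * b (k - l) $ m $ j) sums (mexp A $ i $ m * mexp (- A) $ m $ j)"
      for m
      unfolding mexp_component a_def b_def by (intro Cauchy_product_sums summable_norm_mexp_component)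
    then have "(\<lambda>k. \<Sum>m\<in>UNIV. \<Sum>l\<le>k. a l $ i $ m * b (k - l) $ m $ j) sums
        ((mexp A ** mexp (- A)) $ i $ j)"
      unfolding matrix_matrix_mult_def by (simp add: sums_sum)
    also have "(\<lambda>k. \<Sum>m\<in>UNIV. \<Sum>l\<le>k. a l $ i $ m * b (k - l) $ m $ j) =
        (\<lambda>k. (\<Sum>l\<le>k. a l ** b (k - l)) $ i $ j)"
      by (subst sum.swap) (simp add: matrix_matrix_mult_def)
    also have "\<dots> = (\<lambda>k. if k = 0 then mat 1 $ i $ j else 0)"
      unfolding prod by auto
    finally have "(\<lambda>k. if k = 0 then mat 1 $ i $ j else 0) sums ((mexp A ** mexp (- A)) $ i $ j)" .
    moreover have "(\<lambda>k. if k = 0 then mat 1 $ i $ j else 0) sums (mat 1 $ i $ j :: complex)"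
      by (rule sums_single)
    ultimately show ?thesis by (rule sums_unique2)
  qed
  then show ?thesis by (simp add: vec_eq_iff)
qed

section \<open>Hermitian conjugates, unitary matrices and the trace\<close>

lemma hermitian_conj_mul: "hermitian_conj (A ** B) = hermitian_conj B ** hermitian_conj A"
  by (simp add: hermitian_conj_def matrix_matrix_mult_def vec_eq_iff mult.commute)

lemma hermitian_conj_hermitian_conj: "hermitian_conj (hermitian_conj A) = A"
  by (simp add: hermitian_conj_def vec_eq_iff)

lemma matrix_inv_unique:
  fixes A B :: "complex^'n^'n"
  assumes "A ** B = mat 1" "B ** A = mat 1"
  shows "matrix_inv A = B"
  unfolding matrix_inv_def
proof (rule some_equality)
  fix C assume "A ** C = mat 1 \<and> C ** A = mat 1"
  then show "C = B"
    using assms by (metis matrix_mul_assoc matrix_mul_lid matrix_mul_rid)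
qed (use assms in simp)

lemma unitary_mat_inv: "unitary_mat A \<Longrightarrow> matrix_inv A = hermitian_conj A"
  by (simp add: unitary_mat_def matrix_inv_unique)

lemma matrix_diff_ldistrib: "A ** (B - C) = A ** B - A ** (C :: complex^'n^'n)"
  by (simp add: matrix_matrix_mult_def vec_eq_iff sum_subtractf algebra_simps)

lemma matrix_diff_rdistrib: "(B - C) ** A = B ** A - C ** (A :: complex^'n^'n)"
  by (simp add: matrix_matrix_mult_def vec_eq_iff sum_subtractf algebra_simps)

lemma unitary_mul_cancel:
  assumes "unitary_mat G"
  shows "hermitian_conj G ** (G ** X) = X" "G ** (hermitian_conj G ** X) = X"
  using assms by (simp_all add: unitary_mat_def matrix_mul_assoc)

text \<open>\<open>G\<close> and \<open>H\<close> stand for the gauge values at the origins of the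
  faces with holonomies \<open>E\<close> and \<open>F\<close>. Conjugation by a unitary matrix fixes
  the unit matrix, so each bracket is conjugated along with its holonomy. The inner gauge factors
  cancel, the whole product is conjugated by \<open>H\<close>, and cyclicity of the trace removes
  \<open>H\<close>.\<close>

lemma trace_holonomies_gauge:
  fixes G H :: "complex^'n^'n"
  assumes G: "unitary_mat G" and H: "unitary_mat H"
    and U: "U' = H ** U ** hermitian_conj G" and V: "V' = G ** V ** hermitian_conj H"
    and E: "E' = G ** E ** hermitian_conj G" and F: "F' = H ** F ** hermitian_conj H"
  shows "trace (U' ** (mat 1 - hermitian_conj E') ** V' ** (mat 1 - F')) =
         trace (U ** (mat 1 - hermitian_conj E) ** V ** (mat 1 - F))"
proof -
  have GG: "G ** hermitian_conj G = mat 1" and HH: "H ** hermitian_conj H = mat 1"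
    using G H by (simp_all add: unitary_mat_def)
  have E1: "mat 1 - hermitian_conj E' = G ** (mat 1 - hermitian_conj E) ** hermitian_conj G"
    by (simp add: E hermitian_conj_mul hermitian_conj_hermitian_conj matrix_diff_ldistrib
        matrix_diff_rdistrib GG matrix_mul_assoc)
  have F1: "mat 1 - F' = H ** (mat 1 - F) ** hermitian_conj H"
    by (simp add: F matrix_diff_ldistrib matrix_diff_rdistrib HH)
  have "U' ** (mat 1 - hermitian_conj E') ** V' ** (mat 1 - F') =
      H ** ((U ** (mat 1 - hermitian_conj E) ** V ** (mat 1 - F)) ** hermitian_conj H)"
    unfolding E1 F1 U V
    by (simp only: matrix_mul_assoc[symmetric] unitary_mul_cancel[OF G] unitary_mul_cancel[OF H])
  also have "trace \<dots> = trace ((U ** (mat 1 - hermitian_conj E) ** V ** (mat 1 - F)) **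
      (hermitian_conj H ** H))"
    by (subst trace_mul_sym) (simp add: matrix_mul_assoc)
  finally show ?thesis
    using H by (simp add: unitary_mat_def)
qed


section \<open>Simplexes\<close>

text \<open>Every subset of an affinely independent set spans a face of the convex hull. Hence
  distinct face origins in \<open>T\<close> are always joined by an edge, and the transport between
  them is not the default value for unjoined vertexes.\<close>

lemma segment_face_of_simplex:
  fixes T :: "'a::euclidean_space set"
  assumes "n simplex T" "i \<in> vertexes T" "j \<in> vertexes T" "i \<noteq> j"
  shows "closed_segment i j face_of T" "1 simplex closed_segment i j"
proof -
  obtain C where C: "\<not> affine_dependent C" "T = convex hull C"
    using assms(1) by (auto simp: simplex_def)
  then have ij: "{i, j} \<subseteq> C"
    using assms(2,3) by (auto simp: vertexes_def extreme_point_of_convex_hull_affine_independent)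
  then show "closed_segment i j face_of T"
    unfolding C(2) face_of_convex_hull_affine_independent[OF C(1)] segment_convex_hull by blast
  show "1 simplex closed_segment i j"
    unfolding simplex_def
    using assms(4) by (intro exI[of _ "{i, j}"]) (simp add: segment_convex_hull affine_independent_2)
qed

lemma vertexes_face_subset: "f face_of T \<Longrightarrow> vertexes f \<subseteq> vertexes T"
  by (auto simp: vertexes_def extreme_point_of_face)

text \<open>Makes the hypothesis on \<open>G\<close>, which concerns 0-simplexes, available at the
  vertexes of \<open>T\<close>.\<close>

lemma vertex_in_simplexes:
  assumes "simplicial_complex \<T>" "T \<in> \<T>" "i \<in> vertexes T"
  shows "{i} \<in> simplexes \<T> 0"
proof -
  have "{i} \<in> \<T>"
    using assms unfolding simplicial_complex_def vertexes_def mem_Collect_eq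
      face_of_singleton[symmetric] by blast
  then show ?thesis by (simp add: simplexes_def)
qed

lemma card_vertexes_simplex:
  assumes "int n simplex S"
  shows "card (vertexes S) = Suc n"
proof -
  obtain C where C: "\<not> affine_dependent C" "int (card C) = int n + 1" "S = convex hull C"
    using assms by (auto simp: simplex_def)
  then have "vertexes S = C"
    by (auto simp: vertexes_def extreme_point_of_convex_hull_affine_independent)
  then show ?thesis using C by simp
qed

section \<open>Rotations of vertex lists\<close>

lemma set_starting_at: "set (starting_at v xs) = set xs"
  using takeWhile_dropWhile_id[of "\<lambda>u. u \<noteq> v" xs] unfolding starting_at_def
  by (metis set_append Un_commute)

lemma length_starting_at: "length (starting_at v xs) = length xs"
  using takeWhile_dropWhile_id[of "\<lambda>u. u \<noteq> v" xs] unfolding starting_at_def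
  by (metis length_append add.commute)

lemma starting_at_nth_0: "v \<in> set xs \<Longrightarrow> starting_at v xs ! 0 = v"
  by (induction xs) (auto simp: starting_at_def nth_append)


section \<open>Gauge transformations\<close>

text \<open>As \<open>[i, j]\<close> differs from \<open>[j, i]\<close>, the two directions of an
  edge fall into different branches of \<open>coefficient\<close> and get opposite values; without
  an edge both values are 0.\<close>

lemma transport_mul_transport: "transport \<T> ori A j i ** transport \<T> ori A i j = mat 1"
  if "ori (closed_segment i j) = [i, j]" "i \<noteq> j"
proof -
  have "coefficient \<T> ori A i j = - coefficient \<T> ori A j i"
    using that by (simp add: coefficient_def closed_segment_commute[of j i])
  then show ?thesis
    using mexp_mul_mexp_uminus[of "- coefficient \<T> ori A j i"] by (simp add: transport_def)
qed

lemma transport_mul_transport':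
  "transport \<T> ori A i j ** transport \<T> ori A j i = mat 1"
  if "ori (closed_segment i j) = [i, j]" "i \<noteq> j"
  using matrix_left_right_inverse transport_mul_transport that by blast

text \<open>Extends the gauge relation from edges in their chosen direction to all ordered pairs of
  vertexes of \<open>T\<close>, equal ones included, since two faces may share their origin.\<close>

lemma transport_gauge:
  fixes G :: "'a::euclidean_space \<Rightarrow> complex^'n^'n"
  assumes \<T>: "simplicial_complex \<T>" and ori: "orientation \<T> ori"
    and T: "T \<in> \<T>" "i \<in> vertexes T" "j \<in> vertexes T"
    and G: "\<And>i. i \<in> vertexes T \<Longrightarrow> unitary_mat (G i)"
    and gauge: "\<And>e i j. e \<in> simplexes \<T> 1 \<Longrightarrow> ori e = [i, j] \<Longrightarrow>
           transport \<T> ori A' j i = G j ** transport \<T> ori A j i ** matrix_inv (G i)"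
  shows "transport \<T> ori A' j i = G j ** transport \<T> ori A j i ** hermitian_conj (G i)"
proof (cases "i = j")
  case True
  \<comment> \<open>An edge has two vertexes, so the degenerate segment \<open>{j}\<close> is not
    one: the coefficient is 0 and the transport is the unit matrix.\<close>
  then have "coefficient \<T> ori B j i = 0" for B :: "'a set \<Rightarrow> 'a \<Rightarrow> 'a \<Rightarrow> complex^'n^'n"
    using card_vertexes_simplex[of 1 "{j}"]
    by (auto simp: coefficient_def simplexes_def vertexes_def)
  then show ?thesis
    using G[OF T(2)] True by (simp add: transport_def mexp_0 unitary_mat_def)
next
  case False
  obtain n where "n simplex T"
    using \<T> T by (auto simp: simplicial_complex_def)
  note seg = segment_face_of_simplex[OF this T(2,3) False]
  have e: "closed_segment i j \<in> simplexes \<T> 1"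
    using seg \<T> T(1) by (auto simp: simplexes_def simplicial_complex_def)
  have "set (ori (closed_segment i j)) = {i, j}" "distinct (ori (closed_segment i j))"
    using ori e by (auto simp: orientation_def simplexes_def vertexes_def extreme_point_of_segment)
  moreover from this have "length (ori (closed_segment i j)) = 2"
    using False distinct_card by fastforce
  ultimately consider "ori (closed_segment i j) = [i, j]" | "ori (closed_segment i j) = [j, i]"
    by (auto simp: length_Suc_conv numeral_2_eq_2 doubleton_eq_iff)
  then show ?thesis
  proof cases
    case 1
    then show ?thesis
      using gauge[OF e 1] by (simp add: unitary_mat_inv G T)
  next
    case 2
    let ?U = "transport \<T> ori A" and ?U' = "transport \<T> ori A'"
    have or: "ori (closed_segment j i) = [j, i]"
      using 2 by (simp add: closed_segment_commute)
    have U': "?U' i j = G i ** ?U i j ** hermitian_conj (G j)"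
      using gauge[OF e 2] by (simp add: unitary_mat_inv G T)
    \<comment> \<open>The claimed value of \<open>?U' j i\<close> is a right inverse of
      \<open>?U' i j\<close>; multiplying by \<open>?U' j i\<close> on the left identifies the
      two.\<close>
    have "?U' i j ** (G j ** ?U j i ** hermitian_conj (G i)) =
        G i ** (?U i j ** ?U j i) ** hermitian_conj (G i)"
      unfolding U' by (simp add: matrix_mul_assoc[symmetric] unitary_mul_cancel G T)
    also have "\<dots> = mat 1"
      using transport_mul_transport[of ori j i \<T> A] or False G[OF T(2)] by (simp add: unitary_mat_def)
    finally have "?U' j i ** (?U' i j ** (G j ** ?U j i ** hermitian_conj (G i))) = ?U' j i"
      by simp
    then show ?thesis
      using transport_mul_transport'[of ori j i \<T> A'] or False by (simp add: matrix_mul_assoc)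
  qed
qed

theorem theorem1:
  fixes \<T> :: "'a::euclidean_space set set"
    and ori :: "'a set \<Rightarrow> 'a list"
    and org :: "'a set \<Rightarrow> 'a"
    and \<G> :: "(complex^'n^'n) set"
    and T :: "'a set"
    and G :: "'a \<Rightarrow> complex^'n^'n"
    and A A' :: "'a set \<Rightarrow> 'a \<Rightarrow> 'a \<Rightarrow> complex^'n^'n"
  assumes "compact_unitary_group \<G>"
    and "simplicial_complex \<T>"
    and "spans_bounded_domain \<T>"
    and "orientation \<T> ori"
    and "origins \<T> org"
    and "T \<in> simplexes \<T> DIM('a)"
    and "\<And>i. {i} \<in> simplexes \<T> 0 \<Longrightarrow> G i \<in> \<G>"
    and "A \<in> whitney1_forms \<T> ori (lie_algebra \<G>)"
    and "A' \<in> whitney1_forms \<T> ori (lie_algebra \<G>)"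
    and "\<And>e i j. e \<in> simplexes \<T> 1 \<Longrightarrow> ori e = [i, j] \<Longrightarrow>
           transport \<T> ori A' j i = G j ** transport \<T> ori A j i ** matrix_inv (G i)"
  shows "discrete_action \<T> ori org T A' = discrete_action \<T> ori org T A"
proof -
  have T: "T \<in> \<T>"
    using assms(6) by (simp add: simplexes_def)
  have G: "unitary_mat (G i)" if "i \<in> vertexes T" for i
    using assms(1) assms(7)[OF vertex_in_simplexes[OF assms(2) T that]]
    by (simp add: compact_unitary_group_def)
  have gauge: "transport \<T> ori A' j i = G j ** transport \<T> ori A j i ** hermitian_conj (G i)"
    if "i \<in> vertexes T" "j \<in> vertexes T" for i j
    by (rule transport_gauge[OF assms(2,4) T that G assms(10)])
  have org: "org f \<in> vertexes T" if "f \<in> simplexes \<T> 2" "f face_of T" for f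
    using assms(5) that vertexes_face_subset by (auto simp: origins_def)
  have hol: "face_holonomy \<T> ori org A' f =
      G (org f) ** face_holonomy \<T> ori org A f ** hermitian_conj (G (org f))"
    if f: "f \<in> simplexes \<T> 2" "f face_of T" for f
  proof -
    let ?l = "starting_at (org f) (ori f)"
    have ori: "distinct (ori f)" "set (ori f) = vertexes f"
      using assms(4) f by (auto simp: orientation_def simplexes_def)
    \<comment> \<open>With exactly three vertexes, the list accesses 0, 1 and 2 in the holonomy are
      in range.\<close>
    have "length (ori f) = 3"
      using distinct_card[OF ori(1)] card_vertexes_simplex[of 2 f] f ori(2)
      by (simp add: simplexes_def)
    then have len: "length ?l = 3"
      by (simp add: length_starting_at)
    have V: "?l ! r \<in> vertexes T" if "r < 3" for r
      using nth_mem[of r ?l] that len vertexes_face_subset[OF f(2)]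
      unfolding set_starting_at ori(2) by auto
    have "org f \<in> set (ori f)"
      using assms(5) f ori(2) by (simp add: origins_def)
    then have "?l ! 0 = org f"
      by (rule starting_at_nth_0)
    \<comment> \<open>The loop starts and ends at the origin, so only the gauge factors there
      survive; those at the other two vertexes cancel in adjacent pairs.\<close>
    then show ?thesis
      using V[of 0] V[of 1] V[of 2]
      by (simp add: face_holonomy_def Let_def gauge matrix_mul_assoc[symmetric]
          unitary_mul_cancel G)
  qed
  \<comment> \<open>The mass matrix does not depend on the form, so the two sums can be compared
    term by term.\<close>
  show ?thesis
    unfolding discrete_action_def Let_def
  proof (intro sum.cong refl, clarify)
    fix f\<^sub>0 f\<^sub>1
    assume f: "f\<^sub>0 \<in> simplexes \<T> 2" "f\<^sub>0 face_of T" "f\<^sub>1 \<in> simplexes \<T> 2" "f\<^sub>1 face_of T"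
    show "mass_matrix \<T> ori T f\<^sub>0 f\<^sub>1 *
        Re (trace (transport \<T> ori A' (org f\<^sub>1) (org f\<^sub>0) **
          (mat 1 - hermitian_conj (face_holonomy \<T> ori org A' f\<^sub>0)) **
          transport \<T> ori A' (org f\<^sub>0) (org f\<^sub>1) ** (mat 1 - face_holonomy \<T> ori org A' f\<^sub>1))) =
      mass_matrix \<T> ori T f\<^sub>0 f\<^sub>1 *
        Re (trace (transport \<T> ori A (org f\<^sub>1) (org f\<^sub>0) **
          (mat 1 - hermitian_conj (face_holonomy \<T> ori org A f\<^sub>0)) **
          transport \<T> ori A (org f\<^sub>0) (org f\<^sub>1) ** (mat 1 - face_holonomy \<T> ori org A f\<^sub>1)))"
      using f by (subst trace_holonomies_gauge[OF G[OF org] G[OF org] gauge[OF org org]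
          gauge[OF org org] hol hol]) auto
  qed
qed

end
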